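(* Let $K:X\times X\to\mathbb{C}$ be a positive definite kernel on a set $X$, and let $\mathscr{H}(K)$ be the corresponding reproducing kernel Hilbert space. Assume $\{\varphi_n\}_{n\in\mathbb{N}}\subset\mathscr{H}(K)$ is a Parseval frame in $\mathscr{H}(K)$. Then the following two assertions hold: (i) For all $(x,y)\in X\times X$ one has $$K(x,y)=\sum_{n\in\mathbb{N}}\varphi_n(x)\overline{\varphi_n(y)},$$ and so $\mathbb{N}$ with counting measure is a boundary for $K$. (ii) Let $\{Z_n\}_{n\in\mathbb{N}}$ be a system of independent, identically distributed standard Gaussian $N(0,1)$ random variables. Then $$V_x(\cdot)=\sum_{n\in\mathbb{N}}\varphi_n(x)Z_n(\cdot),\qquad x\in X,$$ is a Gaussian process indexed by $X$ with covariance kernel $$\mathbb{E}(V_x\overline{V}_y)=K(x,y),\qquad\forall (x,y)\in X\times X.$$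
   Context: All inner products are linear in the second variable. A function $K:X\times X\to\mathbb{C}$ is positive definite if for every finite subset $\{x_i\}_{i=1}^N\subset X$ the matrix $(K(x_i,x_j))$ is positive semidefinite. $\mathscr{H}(K)$ is the Hilbert space of functions on $X$ with $K(\cdot,x)\in\mathscr{H}(K)$ and $f(x)=\langle K(\cdot,x),f\rangle_{\mathscr{H}(K)}$ for all $x\in X$, $f\in\mathscr{H}(K)$. A system $\{\varphi_n\}_{n\in\mathbb{N}}$ in a separable Hilbert space $\mathscr{H}$ is a Parseval frame if $\sum_n|\langle\varphi_n,h\rangle|^2=\|h\|^2$ for all $h\in\mathscr{H}$. A measure space $(B,\mathscr{F}_B,\mu)$ is a boundary for $K$ if there is a system of functions $\{k_x^{(B)}\}_{x\in X}\subset L^2(B,\mu)$ such that $K(x,y)=\int_B\overline{k_x^{(B)}(b)}k_y^{(B)}(b)\,d\mu(b)$ for all $x,y\in X$. The series defining $V_x$ is understood in $L^2$ of the underlying probability space. A (complex valued) process $(V_x)_{x\in X}$ is Gaussian if for any finite set of indices $x_1,\dots,x_m$ the real and imaginary parts of $V_{x_1},\dots,V_{x_m}$ are jointly (possibly degenerate) Gaussian. *)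

theory Defs
  imports "HOL-Probability.Probability"
begin

definition pd_kernel :: "'x set \<Rightarrow> ('x \<Rightarrow> 'x \<Rightarrow> complex) \<Rightarrow> bool" where
  "pd_kernel X K \<longleftrightarrow>
     (\<forall>F c. finite F \<longrightarrow> F \<subseteq> X \<longrightarrow>
        (\<Sum>x\<in>F. \<Sum>y\<in>F. cnj (c x) * K x y * c y) \<in> \<real> \<and>
        0 \<le> Re (\<Sum>x\<in>F. \<Sum>y\<in>F. cnj (c x) * K x y * c y))"

(* A function on the set X is an element of "extensional X"; restricting to X makes the
   representation of such a function unique, so that equality in H is equality on X.
   The inner product ip is linear in its second argument. *)
locale hilbert_function_space =
  fixes X :: "'x set"
    and H :: "('x \<Rightarrow> complex) set"
    and ip :: "('x \<Rightarrow> complex) \<Rightarrow> ('x \<Rightarrow> complex) \<Rightarrow> complex"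
  assumes functions_on: "H \<subseteq> extensional X"
    and zero_mem: "(\<lambda>t\<in>X. 0) \<in> H"
    and add_mem: "\<lbrakk>f \<in> H; g \<in> H\<rbrakk> \<Longrightarrow> (\<lambda>t\<in>X. f t + g t) \<in> H"
    and scale_mem: "f \<in> H \<Longrightarrow> (\<lambda>t\<in>X. c * f t) \<in> H"
    and ip_add: "\<lbrakk>f \<in> H; g \<in> H; h \<in> H\<rbrakk> \<Longrightarrow> ip f (\<lambda>t\<in>X. g t + h t) = ip f g + ip f h"
    and ip_scale: "\<lbrakk>f \<in> H; g \<in> H\<rbrakk> \<Longrightarrow> ip f (\<lambda>t\<in>X. c * g t) = c * ip f g"
    and ip_cnj: "\<lbrakk>f \<in> H; g \<in> H\<rbrakk> \<Longrightarrow> ip g f = cnj (ip f g)"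
    and ip_nonneg: "f \<in> H \<Longrightarrow> 0 \<le> Re (ip f f)"
    and ip_definite: "\<lbrakk>f \<in> H; ip f f = 0\<rbrakk> \<Longrightarrow> f = (\<lambda>t\<in>X. 0)"
    and complete:
      "\<lbrakk>\<And>n. s n \<in> H;
        \<And>e. e > 0 \<Longrightarrow> \<exists>N::nat. \<forall>m\<ge>N. \<forall>n\<ge>N.
          sqrt (Re (ip (\<lambda>t\<in>X. s m t - s n t) (\<lambda>t\<in>X. s m t - s n t))) < e\<rbrakk>
       \<Longrightarrow> \<exists>f\<in>H. (\<lambda>n. sqrt (Re (ip (\<lambda>t\<in>X. s n t - f t) (\<lambda>t\<in>X. s n t - f t))))
                   \<longlonglongrightarrow> 0"

(* (H, ip) is the reproducing kernel Hilbert space of K; the properties below determine it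
   uniquely. *)
locale rkhs = hilbert_function_space X H ip
  for X :: "'x set" and K :: "'x \<Rightarrow> 'x \<Rightarrow> complex"
    and H :: "('x \<Rightarrow> complex) set"
    and ip :: "('x \<Rightarrow> complex) \<Rightarrow> ('x \<Rightarrow> complex) \<Rightarrow> complex" +
  assumes kernel_mem: "x \<in> X \<Longrightarrow> (\<lambda>t\<in>X. K t x) \<in> H"
    and reproducing: "\<lbrakk>x \<in> X; f \<in> H\<rbrakk> \<Longrightarrow> f x = ip (\<lambda>t\<in>X. K t x) f"

(* Separability of H is not listed: it follows, since the Parseval identity makes the
   span of the frame vectors dense. *)
definition parseval_frame ::
    "'v set \<Rightarrow> ('v \<Rightarrow> 'v \<Rightarrow> complex) \<Rightarrow> (nat \<Rightarrow> 'v) \<Rightarrow> bool" where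
  "parseval_frame H ip \<phi> \<longleftrightarrow>
     (\<forall>n. \<phi> n \<in> H) \<and>
     (\<forall>h\<in>H. (\<lambda>n. (cmod (ip (\<phi> n) h))\<^sup>2) sums (sqrt (Re (ip h h)))\<^sup>2)"

definition square_integrable :: "'b measure \<Rightarrow> ('b \<Rightarrow> complex) \<Rightarrow> bool" where
  "square_integrable M f \<longleftrightarrow>
     f \<in> borel_measurable M \<and> integrable M (\<lambda>b. (cmod (f b))\<^sup>2)"

definition is_boundary :: "'x set \<Rightarrow> ('x \<Rightarrow> 'x \<Rightarrow> complex) \<Rightarrow> 'b measure \<Rightarrow> bool" where
  "is_boundary X K M \<longleftrightarrow>
     (\<exists>k :: 'x \<Rightarrow> 'b \<Rightarrow> complex.
        (\<forall>x\<in>X. square_integrable M (k x)) \<and>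
        (\<forall>x\<in>X. \<forall>y\<in>X. K x y = (\<integral>b. cnj (k x b) * k y b \<partial>M)))"

(* The terms are required to be square integrable because the Bochner integral of a
   non-integrable function is 0. *)
definition L2_sums :: "'b measure \<Rightarrow> (nat \<Rightarrow> 'b \<Rightarrow> complex) \<Rightarrow> ('b \<Rightarrow> complex) \<Rightarrow> bool" where
  "L2_sums M f v \<longleftrightarrow>
     (\<forall>n. square_integrable M (f n)) \<and> square_integrable M v \<and>
     (\<lambda>N. \<integral>b. (cmod ((\<Sum>n<N. f n b) - v b))\<^sup>2 \<partial>M) \<longlonglongrightarrow> 0"

(* Normal random variables with variance 0, i.e. almost surely constant ones, are included. *)
definition gaussian_rv :: "'w measure \<Rightarrow> ('w \<Rightarrow> real) \<Rightarrow> bool" where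
  "gaussian_rv M Y \<longleftrightarrow>
     Y \<in> borel_measurable M \<and>
     (\<exists>\<mu>. (\<exists>\<sigma>>0. distributed M lborel Y (normal_density \<mu> \<sigma>)) \<or> (AE \<omega> in M. Y \<omega> = \<mu>))"

(* The definition of a multivariate normal vector that allows singular covariance matrices:
   every real linear combination of the components is normal. *)
definition jointly_gaussian :: "'w measure \<Rightarrow> 'j set \<Rightarrow> ('j \<Rightarrow> 'w \<Rightarrow> real) \<Rightarrow> bool" where
  "jointly_gaussian M J W \<longleftrightarrow>
     (\<forall>a. gaussian_rv M (\<lambda>\<omega>. \<Sum>j\<in>J. a j * W j \<omega>))"

definition gaussian_process :: "'w measure \<Rightarrow> 'x set \<Rightarrow> ('x \<Rightarrow> 'w \<Rightarrow> complex) \<Rightarrow> bool" where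
  "gaussian_process M X V \<longleftrightarrow>
     (\<forall>F. finite F \<longrightarrow> F \<subseteq> X \<longrightarrow>
        jointly_gaussian M (F <+> F)
          (case_sum (\<lambda>x \<omega>. Re (V x \<omega>)) (\<lambda>x \<omega>. Im (V x \<omega>))))"

definition iid_standard_normal :: "'w measure \<Rightarrow> (nat \<Rightarrow> 'w \<Rightarrow> real) \<Rightarrow> bool" where
  "iid_standard_normal M Z \<longleftrightarrow>
     prob_space M \<and> prob_space.indep_vars M (\<lambda>_. borel) Z UNIV \<and>
     (\<forall>n. distributed M lborel (Z n) std_normal_density)"

end

theory Submission
  imports Defs
begin

text \<open>
  Polarising the Parseval identity gives \<open>\<langle>f, g\<rangle> = \<Sum>\<^sub>n \<langle>f, \<phi>\<^sub>n\<rangle> \<langle>\<phi>\<^sub>n, g\<rangle>\<close>; for \<open>f = K(\<cdot>, x)\<close> and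
  \<open>g = K(\<cdot>, y)\<close> the reproducing property turns this into the expansion of \<open>K(x, y)\<close>. In particular
  \<open>(\<phi>\<^sub>n(x))\<^sub>n\<close> is square summable. The \<open>Z\<^sub>n\<close> are orthonormal in \<open>L\<^sup>2\<close>, so the series for \<open>V\<^sub>x\<close> converges by
  completeness, and the covariance is the limit of the inner products of the partial sums. A real
  linear combination of real and imaginary parts of the \<open>V\<^sub>x\<close> is an \<open>L\<^sup>1\<close> limit of combinations of the
  \<open>Z\<^sub>n\<close>; the characteristic functions \<open>exp (- s\<^sub>N t\<^sup>2 / 2)\<close> of the latter converge to
  \<open>exp (- s t\<^sup>2 / 2)\<close>, so the limit is normal by Levy's uniqueness theorem, or zero almost surely
  when \<open>s = 0\<close>.
\<close>

section \<open>Polarisation of the Parseval identity\<close>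

text \<open>For \<open>cmod c = 1\<close> the squared norm of \<open>f + c g\<close> is that of
  \<open>f\<close> plus that of \<open>g\<close> plus \<open>2 Re (c * ip f g)\<close>, and every
  frame coefficient splits in the same way. Subtracting the three Parseval series leaves a series
  for the cross term.\<close>

lemma (in hilbert_function_space) parseval_frame_ip_sums:
  assumes frame: "parseval_frame H ip \<phi>" and f: "f \<in> H" and g: "g \<in> H"
  shows "(\<lambda>n. cnj (ip (\<phi> n) f) * ip (\<phi> n) g) sums ip f g"
proof -
  have \<phi>: "\<phi> n \<in> H" for n
    using frame by (simp add: parseval_frame_def)
  have norm_sums: "(\<lambda>n. (cmod (ip (\<phi> n) h))\<^sup>2) sums Re (ip h h)" if "h \<in> H" for h
    using frame that ip_nonneg by (simp add: parseval_frame_def)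
  have cross: "(\<lambda>n. Re (c * (cnj (ip (\<phi> n) f) * ip (\<phi> n) g))) sums Re (c * ip f g)"
    if c: "cmod c = 1" for c
  proof -
    define cg where "cg = (\<lambda>t\<in>X. c * g t)"
    define h where "h = (\<lambda>t\<in>X. f t + cg t)"
    have cg: "cg \<in> H" and h: "h \<in> H"
      unfolding h_def cg_def by (intro scale_mem add_mem f g)+
    have ip_cg: "ip u cg = c * ip u g" if "u \<in> H" for u
      unfolding cg_def by (rule ip_scale[OF that g])
    have ip_h: "ip u h = ip u f + c * ip u g" if "u \<in> H" for u
      unfolding h_def using ip_add[OF that f cg] ip_cg[OF that] by simp
    have cc: "c * cnj c = 1"
      using c by (simp add: complex_norm_square[symmetric])
    have "ip h h = cnj (ip f h) + c * cnj (ip g h)"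
      using ip_h[OF h] ip_cnj[OF f h] ip_cnj[OF g h] by simp
    also have "\<dots> = cnj (ip f f) + cnj (c * ip f g) + c * cnj (ip g f) + (c * cnj c) * cnj (ip g g)"
      by (simp add: ip_h f g algebra_simps)
    also have "\<dots> = ip f f + ip g g + (c * ip f g + cnj (c * ip f g))"
      using ip_cnj[OF f f] ip_cnj[OF g g] ip_cnj[OF f g] cc by simp
    finally have "Re (ip h h) = Re (ip f f) + Re (ip g g) + 2 * Re (c * ip f g)"
      by simp
    moreover have "(cmod (ip (\<phi> n) h))\<^sup>2 = (cmod (ip (\<phi> n) f))\<^sup>2 + (cmod (ip (\<phi> n) g))\<^sup>2
        + 2 * Re (c * (cnj (ip (\<phi> n) f) * ip (\<phi> n) g))" for n
    proof -
      have "(cmod (ip (\<phi> n) h))\<^sup>2 = (cmod (ip (\<phi> n) f))\<^sup>2 + (cmod (c * ip (\<phi> n) g))\<^sup>2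
        + 2 * Re (c * (cnj (ip (\<phi> n) f) * ip (\<phi> n) g))"
        unfolding ip_h[OF \<phi>] cmod_power2 by (simp add: power2_eq_square algebra_simps)
      then show ?thesis using c by (simp add: norm_mult)
    qed
    \<comment> \<open>Both expansions are solved for the cross term.
      \<open>times_complex.sel\<close> is withheld so that the real part of a product stays a single
      atom.\<close>
    ultimately have
      "(\<lambda>n. Re (c * (cnj (ip (\<phi> n) f) * ip (\<phi> n) g)))
        = (\<lambda>n. ((cmod (ip (\<phi> n) h))\<^sup>2 - (cmod (ip (\<phi> n) f))\<^sup>2 - (cmod (ip (\<phi> n) g))\<^sup>2) / 2)"
      "Re (c * ip f g) = (Re (ip h h) - Re (ip f f) - Re (ip g g)) / 2"
      by (simp_all only:) (simp_all del: times_complex.sel)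
    then show ?thesis
      by (simp only:) (intro sums_divide sums_diff norm_sums f g h)
  qed
  \<comment> \<open>Since \<open>Re (- \<i> * z) = Im z\<close>, the two choices of \<open>c\<close>
    give the real and the imaginary part.\<close>
  show ?thesis
    using cross[of 1] cross[of "- \<i>"] by (simp add: sums_complex_iff)
qed

section \<open>Square integrable functions\<close>

text \<open>As a destruction rule this lets square integrability facts be declared
  \<open>[measurable]\<close> directly.\<close>

lemma square_integrable_borel_measurable [measurable_dest]:
  "square_integrable M f \<Longrightarrow> f \<in> borel_measurable M"
  by (simp add: square_integrable_def)

lemma square_integrable_norm2:
  "square_integrable M f \<Longrightarrow> integrable M (\<lambda>b. (cmod (f b))\<^sup>2)"
  by (simp add: square_integrable_def)

lemma square_integrable_cnj:
  "square_integrable M f \<Longrightarrow> square_integrable M (\<lambda>b. cnj (f b))"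
  by (simp add: square_integrable_def borel_measurable_complex_iff)

lemma square_integrable_cmult:
  "square_integrable M f \<Longrightarrow> square_integrable M (\<lambda>b. c * f b)"
  unfolding square_integrable_def by (auto simp: norm_mult power_mult_distrib)

lemma square_integrable_norm:
  "square_integrable M f \<Longrightarrow> square_integrable M (\<lambda>b. complex_of_real (cmod (f b)))"
  unfolding square_integrable_def by auto

text \<open>A cheap replacement for Minkowski's inequality: the factor 2 is harmless for
  integrability and for convergence to 0.\<close>

lemma cmod_add_power2_le:
  "(cmod (z + w))\<^sup>2 \<le> 2 * (cmod z)\<^sup>2 + 2 * (cmod w)\<^sup>2"
proof -
  have "(cmod (z + w))\<^sup>2 \<le> (cmod z + cmod w)\<^sup>2"
    by (intro power_mono norm_triangle_ineq) auto
  also have "\<dots> \<le> 2 * (cmod z)\<^sup>2 + 2 * (cmod w)\<^sup>2"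
    using sum_squares_bound[of "cmod z" "cmod w"] by (simp add: power2_sum)
  finally show ?thesis .
qed

lemma square_integrable_add:
  assumes f: "square_integrable M f" and g: "square_integrable M g"
  shows "square_integrable M (\<lambda>b. f b + g b)"
  unfolding square_integrable_def
proof
  note [measurable] = f g
  show "(\<lambda>b. f b + g b) \<in> borel_measurable M" by measurable
  show "integrable M (\<lambda>b. (cmod (f b + g b))\<^sup>2)"
    by (rule Bochner_Integration.integrable_bound
          [where f = "\<lambda>b. 2 * (cmod (f b))\<^sup>2 + 2 * (cmod (g b))\<^sup>2"])
       (use f g cmod_add_power2_le in \<open>auto simp: square_integrable_norm2\<close>)
qed

lemma square_integrable_diff:
  assumes "square_integrable M f" and "square_integrable M g"
  shows "square_integrable M (\<lambda>b. f b - g b)"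
  using square_integrable_add[OF assms(1) square_integrable_cmult[OF assms(2), of "-1"]]
  by simp

lemma square_integrable_sum:
  assumes "\<And>n. n \<in> A \<Longrightarrow> square_integrable M (f n)"
  shows "square_integrable M (\<lambda>b. \<Sum>n\<in>A. f n b)"
  using assms
  by (induction A rule: infinite_finite_induct)
     (simp_all add: square_integrable_add, simp_all add: square_integrable_def)

text \<open>Cauchy-Schwarz is applied to nonnegative integrals, which make sense before
  \<open>f * g\<close> is known to be integrable. The finite bound yields integrability, and then
  the same inequality can be read with Bochner integrals.\<close>

lemma square_integrable_mult:
  assumes f: "square_integrable M f" and g: "square_integrable M g"
  shows integrable_mult_square_integrable: "integrable M (\<lambda>b. f b * g b)"
    and norm_integral_mult_le_L2:
      "cmod (\<integral>b. f b * g b \<partial>M)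
        \<le> sqrt (\<integral>b. (cmod (f b))\<^sup>2 \<partial>M) * sqrt (\<integral>b. (cmod (g b))\<^sup>2 \<partial>M)"
proof -
  note [measurable] = f g
  have "(\<integral>\<^sup>+b. ennreal (cmod (f b)) * ennreal (cmod (g b)) \<partial>M)\<^sup>2
      \<le> (\<integral>\<^sup>+b. (ennreal (cmod (f b)))\<^sup>2 \<partial>M) * (\<integral>\<^sup>+b. (ennreal (cmod (g b)))\<^sup>2 \<partial>M)"
    by (rule Cauchy_Schwarz_nn_integral) measurable
  also have "\<dots> = ennreal ((\<integral>b. (cmod (f b))\<^sup>2 \<partial>M) * (\<integral>b. (cmod (g b))\<^sup>2 \<partial>M))"
    using f g
    by (simp add: ennreal_power nn_integral_eq_integral square_integrable_norm2 ennreal_mult)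
  finally have CS: "(\<integral>\<^sup>+b. ennreal (cmod (f b * g b)) \<partial>M)\<^sup>2
      \<le> ennreal ((\<integral>b. (cmod (f b))\<^sup>2 \<partial>M) * (\<integral>b. (cmod (g b))\<^sup>2 \<partial>M))"
    by (simp add: norm_mult ennreal_mult)
  then have "(\<integral>\<^sup>+b. ennreal (cmod (f b * g b)) \<partial>M)\<^sup>2 < \<infinity>"
    by (rule order_le_less_trans) simp
  then show int: "integrable M (\<lambda>b. f b * g b)"
    by (simp add: integrable_iff_bounded power_less_top_ennreal)
  have "(\<integral>b. cmod (f b * g b) \<partial>M)\<^sup>2
      \<le> (\<integral>b. (cmod (f b))\<^sup>2 \<partial>M) * (\<integral>b. (cmod (g b))\<^sup>2 \<partial>M)"
    using CS int
    by (subst (asm) nn_integral_eq_integral) (auto simp: ennreal_power)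
  then have "(\<integral>b. cmod (f b * g b) \<partial>M)
      \<le> sqrt (\<integral>b. (cmod (f b))\<^sup>2 \<partial>M) * sqrt (\<integral>b. (cmod (g b))\<^sup>2 \<partial>M)"
    by (simp add: real_le_rsqrt real_sqrt_mult[symmetric])
  then show "cmod (\<integral>b. f b * g b \<partial>M)
        \<le> sqrt (\<integral>b. (cmod (f b))\<^sup>2 \<partial>M) * sqrt (\<integral>b. (cmod (g b))\<^sup>2 \<partial>M)"
    using integral_norm_bound[of M "\<lambda>b. f b * g b"] by linarith
qed

lemma (in finite_measure) square_integrable_const: "square_integrable M (\<lambda>_. c)"
  by (simp add: square_integrable_def)

lemma (in finite_measure) integrable_if_square_integrable:
  "square_integrable M f \<Longrightarrow> integrable M f"
  using integrable_mult_square_integrable[OF _ square_integrable_const[of 1]] by simp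

text \<open>Cauchy-Schwarz for \<open>cmod f\<close> and the constant 1, whose norm is the square
  root of the total mass.\<close>

lemma (in finite_measure) L1_norm_le_L2_norm:
  assumes "square_integrable M f"
  shows "(\<integral>b. cmod (f b) \<partial>M) \<le> sqrt (\<integral>b. (cmod (f b))\<^sup>2 \<partial>M) * sqrt (measure M (space M))"
  using norm_integral_mult_le_L2[OF square_integrable_norm[OF assms] square_integrable_const[of 1]]
  by (simp add: integral_nonneg_AE)

text \<open>The Riesz-Fischer argument: on a finite measure space an L2 Cauchy sequence is L1
  Cauchy, so a subsequence converges almost everywhere. Fatou's lemma then turns the Cauchy estimate
  into L2 convergence of the whole sequence to that pointwise limit.\<close>

lemma (in finite_measure) L2_complete:
  fixes s :: "nat \<Rightarrow> 'a \<Rightarrow> complex"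
  assumes s: "\<And>n. square_integrable M (s n)"
    and cauchy: "\<And>e. e > 0 \<Longrightarrow> \<exists>N. \<forall>i\<ge>N. \<forall>j\<ge>N. (\<integral>b. (cmod (s i b - s j b))\<^sup>2 \<partial>M) < e"
  obtains v where "square_integrable M v"
    and "(\<lambda>n. \<integral>b. (cmod (s n b - v b))\<^sup>2 \<partial>M) \<longlonglongrightarrow> 0"
proof -
  note [measurable] = s
  have s_diff: "square_integrable M (\<lambda>b. s i b - s j b)" for i j
    by (intro square_integrable_diff s)
  obtain r where r: "strict_mono r" and ae: "AE b in M. Cauchy (\<lambda>i. s (r i) b)"
  proof (rule cauchy_L1_AE_cauchy_subseq[of M s])
    show "integrable M (s n)" for n
      by (rule integrable_if_square_integrable[OF s])
    fix e :: real assume "e > 0"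
    define c where "c = sqrt (measure M (space M))"
    have c: "c \<ge> 0" by (simp add: c_def)
    \<comment> \<open>Dividing by \<open>1 + c\<close> instead of \<open>c\<close> covers total mass
      0 and keeps the final bound \<open>e * c / (1 + c) < e\<close> strict.\<close>
    have "(e / (1 + c))\<^sup>2 > 0" using \<open>e > 0\<close> c by simp
    then obtain N where N: "\<And>i j. i \<ge> N \<Longrightarrow> j \<ge> N \<Longrightarrow>
        (\<integral>b. (cmod (s i b - s j b))\<^sup>2 \<partial>M) < (e / (1 + c))\<^sup>2"
      using cauchy by blast
    have "(\<integral>b. cmod (s i b - s j b) \<partial>M) < e" if "i \<ge> N" "j \<ge> N" for i j
    proof -
      have "sqrt (\<integral>b. (cmod (s i b - s j b))\<^sup>2 \<partial>M) \<le> e / (1 + c)"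
        using N[OF that] \<open>e > 0\<close> c by (intro real_le_lsqrt) auto
      then have "(\<integral>b. cmod (s i b - s j b) \<partial>M) \<le> e / (1 + c) * c"
        using L1_norm_le_L2_norm[OF s_diff, of i j] c
        by (smt (verit) c_def mult_right_mono)
      also have "\<dots> < e"
        using \<open>e > 0\<close> c by (simp add: field_simps)
      finally show ?thesis .
    qed
    then show "\<exists>N. \<forall>i\<ge>N. \<forall>j\<ge>N. (\<integral>b. cmod (s i b - s j b) \<partial>M) < e"
      by blast
  qed
  \<comment> \<open>Where the subsequence diverges, \<open>lim\<close> is one fixed unspecified
    value; this keeps \<open>v\<close> measurable and happens only on a null set.\<close>
  define v where "v = (\<lambda>b. lim (\<lambda>i. s (r i) b))"
  have v_meas [measurable]: "v \<in> borel_measurable M"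
    unfolding v_def by (intro borel_measurable_lim_metric) measurable
  have lim_v: "AE b in M. (\<lambda>i. s (r i) b) \<longlonglongrightarrow> v b"
    using ae unfolding v_def
    by eventually_elim (simp add: Cauchy_convergent convergent_LIMSEQ_iff[symmetric])
  \<comment> \<open>Stated with nonnegative integrals, because \<open>v\<close> is not yet known to
    be square integrable. Fatou is applied along the subsequence with \<open>j\<close>
    fixed.\<close>
  have tail: "\<exists>N. \<forall>j\<ge>N. (\<integral>\<^sup>+b. ennreal ((cmod (s j b - v b))\<^sup>2) \<partial>M) \<le> ennreal e" if "e > 0" for e
  proof -
    obtain N where N: "\<And>i j. i \<ge> N \<Longrightarrow> j \<ge> N \<Longrightarrow> (\<integral>b. (cmod (s i b - s j b))\<^sup>2 \<partial>M) < e"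
      using cauchy[OF \<open>e > 0\<close>] by blast
    have "(\<integral>\<^sup>+b. ennreal ((cmod (s j b - v b))\<^sup>2) \<partial>M) \<le> ennreal e" if j: "j \<ge> N" for j
    proof -
      have "(\<integral>\<^sup>+b. ennreal ((cmod (s j b - v b))\<^sup>2) \<partial>M)
          \<le> (\<integral>\<^sup>+b. liminf (\<lambda>i. ennreal ((cmod (s j b - s (r i) b))\<^sup>2)) \<partial>M)"
      proof (rule nn_integral_mono_AE)
        show "AE b in M. ennreal ((cmod (s j b - v b))\<^sup>2)
            \<le> liminf (\<lambda>i. ennreal ((cmod (s j b - s (r i) b))\<^sup>2))"
          using lim_v
        proof eventually_elim
          case (elim b)
          then have "(\<lambda>i. ennreal ((cmod (s j b - s (r i) b))\<^sup>2))
              \<longlonglongrightarrow> ennreal ((cmod (s j b - v b))\<^sup>2)"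
            by (intro tendsto_intros)
          from lim_imp_Liminf[OF _ this] show ?case by simp
        qed
      qed
      also have "\<dots> \<le> liminf (\<lambda>i. \<integral>\<^sup>+b. ennreal ((cmod (s j b - s (r i) b))\<^sup>2) \<partial>M)"
        by (rule nn_integral_liminf) measurable
      also have "\<dots> \<le> ennreal e"
      proof (rule Liminf_le)
        have "(\<integral>\<^sup>+b. ennreal ((cmod (s j b - s (r i) b))\<^sup>2) \<partial>M) \<le> ennreal e" if "i \<ge> N" for i
        proof -
          have "r i \<ge> N" using seq_suble[OF r, of i] that by simp
          then show ?thesis
            using N[OF j \<open>r i \<ge> N\<close>] s_diff[of j "r i"]
            by (subst nn_integral_eq_integral) (auto simp: square_integrable_norm2 intro: ennreal_leI)
        qed
        then show "\<forall>\<^sub>F i in sequentially.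
            (\<integral>\<^sup>+b. ennreal ((cmod (s j b - s (r i) b))\<^sup>2) \<partial>M) \<le> ennreal e"
          unfolding eventually_sequentially by blast
      qed simp
      finally show ?thesis .
    qed
    then show ?thesis by blast
  qed
  have sq_diff: "square_integrable M (\<lambda>b. s j b - v b)"
    if "(\<integral>\<^sup>+b. ennreal ((cmod (s j b - v b))\<^sup>2) \<partial>M) \<le> ennreal e" for j e
    unfolding square_integrable_def integrable_iff_bounded
    using that by (auto intro: order_le_less_trans)
  have v: "square_integrable M v"
  proof -
    obtain j where "(\<integral>\<^sup>+b. ennreal ((cmod (s j b - v b))\<^sup>2) \<partial>M) \<le> ennreal 1"
      using tail[of 1] by auto
    \<comment> \<open>Here \<open>v\<close> is written as \<open>s j - (s j - v)\<close>.\<close>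
    from square_integrable_diff[OF s[of j] sq_diff[OF this]] show ?thesis by simp
  qed
  moreover have "(\<lambda>n. \<integral>b. (cmod (s n b - v b))\<^sup>2 \<partial>M) \<longlonglongrightarrow> 0"
  proof (rule LIMSEQ_I)
    fix e :: real assume "e > 0"
    obtain N where N: "\<And>j. j \<ge> N \<Longrightarrow> (\<integral>\<^sup>+b. ennreal ((cmod (s j b - v b))\<^sup>2) \<partial>M) \<le> ennreal (e / 2)"
      using tail[of "e / 2"] \<open>e > 0\<close> by auto
    have "(\<integral>b. (cmod (s j b - v b))\<^sup>2 \<partial>M) \<le> e / 2" if "j \<ge> N" for j
      using N[OF that] square_integrable_diff[OF s[of j] v] \<open>e > 0\<close>
      by (subst (asm) nn_integral_eq_integral) (auto simp: square_integrable_norm2)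
    then show "\<exists>N. \<forall>n\<ge>N. norm ((\<integral>b. (cmod (s n b - v b))\<^sup>2 \<partial>M) - 0) < e"
      using \<open>e > 0\<close> by (intro exI[of _ N]) (fastforce simp: integral_nonneg_AE)
  qed
  ultimately show thesis by (rule that)
qed

text \<open>The difference of the integrands is split as
  \<open>(S - V) cnj (T - W) + (S - V) cnj W + V cnj (T - W)\<close>. By Cauchy-Schwarz each term is
  bounded by a product containing a factor that tends to 0, and the only other norms are those of
  the fixed limits.\<close>

lemma tendsto_integral_mult_cnj_L2:
  assumes S: "\<And>n. square_integrable M (S n)" and V: "square_integrable M V"
    and T: "\<And>n. square_integrable M (T n)" and W: "square_integrable M W"
    and SV: "(\<lambda>n. \<integral>b. (cmod (S n b - V b))\<^sup>2 \<partial>M) \<longlonglongrightarrow> 0"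
    and TW: "(\<lambda>n. \<integral>b. (cmod (T n b - W b))\<^sup>2 \<partial>M) \<longlonglongrightarrow> 0"
  shows "(\<lambda>n. \<integral>b. S n b * cnj (T n b) \<partial>M) \<longlonglongrightarrow> (\<integral>b. V b * cnj (W b) \<partial>M)"
proof (rule Lim_null_comparison[THEN LIM_zero_cancel])
  let ?d = "\<lambda>n. sqrt (\<integral>b. (cmod (S n b - V b))\<^sup>2 \<partial>M)"
  let ?e = "\<lambda>n. sqrt (\<integral>b. (cmod (T n b - W b))\<^sup>2 \<partial>M)"
  let ?V = "sqrt (\<integral>b. (cmod (V b))\<^sup>2 \<partial>M)"
  let ?W = "sqrt (\<integral>b. (cmod (W b))\<^sup>2 \<partial>M)"
  show "\<forall>\<^sub>F n in sequentially.
      norm ((\<integral>b. S n b * cnj (T n b) \<partial>M) - (\<integral>b. V b * cnj (W b) \<partial>M))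
        \<le> ?d n * ?e n + ?d n * ?W + ?V * ?e n"
  proof (intro always_eventually allI)
    fix n
    let ?p = "\<lambda>b. (S n b - V b) * cnj (T n b - W b)"
    let ?q = "\<lambda>b. (S n b - V b) * cnj (W b)"
    let ?r = "\<lambda>b. V b * cnj (T n b - W b)"
    note sq = square_integrable_diff square_integrable_cnj S T V W
    have int: "integrable M ?p" "integrable M ?q" "integrable M ?r"
      "integrable M (\<lambda>b. S n b * cnj (T n b))" "integrable M (\<lambda>b. V b * cnj (W b))"
      by (intro integrable_mult_square_integrable sq)+
    have "(\<integral>b. S n b * cnj (T n b) \<partial>M) - (\<integral>b. V b * cnj (W b) \<partial>M)
        = (\<integral>b. S n b * cnj (T n b) - V b * cnj (W b) \<partial>M)"
      by (rule Bochner_Integration.integral_diff[symmetric]) fact+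
    also have "\<dots> = (\<integral>b. ?p b + ?q b + ?r b \<partial>M)"
      by (intro Bochner_Integration.integral_cong) (auto simp: algebra_simps)
    also have "\<dots> = (\<integral>b. ?p b \<partial>M) + (\<integral>b. ?q b \<partial>M) + (\<integral>b. ?r b \<partial>M)"
      using int(1-3) by simp
    finally have "norm ((\<integral>b. S n b * cnj (T n b) \<partial>M) - (\<integral>b. V b * cnj (W b) \<partial>M))
        \<le> norm (\<integral>b. ?p b \<partial>M) + norm (\<integral>b. ?q b \<partial>M) + norm (\<integral>b. ?r b \<partial>M)"
      by (simp only:) (intro order_trans[OF norm_triangle_ineq] add_right_mono norm_triangle_ineq)
    moreover have "norm (\<integral>b. ?p b \<partial>M) \<le> ?d n * ?e n"
      using norm_integral_mult_le_L2[of M "\<lambda>b. S n b - V b" "\<lambda>b. cnj (T n b - W b)"]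
      by (simp only: complex_mod_cnj) (simp add: sq del: complex_cnj_diff)
    moreover have "norm (\<integral>b. ?q b \<partial>M) \<le> ?d n * ?W"
      using norm_integral_mult_le_L2[of M "\<lambda>b. S n b - V b" "\<lambda>b. cnj (W b)"]
      by (simp only: complex_mod_cnj) (simp add: sq del: complex_cnj_diff)
    moreover have "norm (\<integral>b. ?r b \<partial>M) \<le> ?V * ?e n"
      using norm_integral_mult_le_L2[of M V "\<lambda>b. cnj (T n b - W b)"]
      by (simp only: complex_mod_cnj) (simp add: sq del: complex_cnj_diff)
    ultimately show "norm ((\<integral>b. S n b * cnj (T n b) \<partial>M) - (\<integral>b. V b * cnj (W b) \<partial>M))
        \<le> ?d n * ?e n + ?d n * ?W + ?V * ?e n"
      by linarith
  qed
  have "?d \<longlonglongrightarrow> 0" "?e \<longlonglongrightarrow> 0"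
    using tendsto_real_sqrt[OF SV] tendsto_real_sqrt[OF TW] by simp_all
  then have "(\<lambda>n. ?d n * ?e n + ?d n * ?W + ?V * ?e n) \<longlonglongrightarrow> 0 * 0 + 0 * ?W + ?V * 0"
    by (intro tendsto_add tendsto_mult tendsto_const)
  then show "(\<lambda>n. ?d n * ?e n + ?d n * ?W + ?V * ?e n) \<longlonglongrightarrow> 0"
    by simp
qed

section \<open>Linearity of L2 convergent series\<close>

lemma L2_sums_add:
  assumes f: "L2_sums M f v" and g: "L2_sums M g w"
  shows "L2_sums M (\<lambda>n b. f n b + g n b) (\<lambda>b. v b + w b)"
proof -
  have sq: "square_integrable M (f n)" "square_integrable M v"
    "square_integrable M (g n)" "square_integrable M w" for n
    using f g by (auto simp: L2_sums_def)
  let ?F = "\<lambda>N b. (\<Sum>n<N. f n b) - v b"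
  let ?G = "\<lambda>N b. (\<Sum>n<N. g n b) - w b"
  let ?E = "\<lambda>N b. (\<Sum>n<N. f n b + g n b) - (v b + w b)"
  have F: "square_integrable M (?F N)" and G: "square_integrable M (?G N)" for N
    by (intro square_integrable_diff square_integrable_sum sq)+
  have E: "?E N b = ?F N b + ?G N b" for N b
    by (simp add: sum.distrib)
  have "(\<integral>b. (cmod (?E N b))\<^sup>2 \<partial>M)
      \<le> 2 * (\<integral>b. (cmod (?F N b))\<^sup>2 \<partial>M) + 2 * (\<integral>b. (cmod (?G N b))\<^sup>2 \<partial>M)" for N
  proof -
    have "(\<integral>b. (cmod (?E N b))\<^sup>2 \<partial>M)
        \<le> (\<integral>b. 2 * (cmod (?F N b))\<^sup>2 + 2 * (cmod (?G N b))\<^sup>2 \<partial>M)"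
      unfolding E using F[of N] G[of N]
      by (intro integral_mono cmod_add_power2_le)
         (auto intro!: square_integrable_norm2 square_integrable_add)
    also have "\<dots> = 2 * (\<integral>b. (cmod (?F N b))\<^sup>2 \<partial>M) + 2 * (\<integral>b. (cmod (?G N b))\<^sup>2 \<partial>M)"
      using square_integrable_norm2[OF F[of N]] square_integrable_norm2[OF G[of N]] by simp
    finally show ?thesis .
  qed
  moreover have "(\<lambda>N. 2 * (\<integral>b. (cmod (?F N b))\<^sup>2 \<partial>M) + 2 * (\<integral>b. (cmod (?G N b))\<^sup>2 \<partial>M))
      \<longlonglongrightarrow> 2 * 0 + 2 * 0"
    using f g unfolding L2_sums_def by (intro tendsto_add tendsto_mult tendsto_const) auto
  ultimately have "(\<lambda>N. \<integral>b. (cmod (?E N b))\<^sup>2 \<partial>M) \<longlonglongrightarrow> 0"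
    by (intro Lim_null_comparison[of "\<lambda>N. \<integral>b. (cmod (?E N b))\<^sup>2 \<partial>M"] always_eventually allI)
       (simp_all add: integral_nonneg_AE)
  then show ?thesis
    using sq by (simp add: L2_sums_def square_integrable_add)
qed

lemma L2_sums_cmult:
  assumes "L2_sums M f v"
  shows "L2_sums M (\<lambda>n b. c * f n b) (\<lambda>b. c * v b)"
proof -
  have "(\<integral>b. (cmod ((\<Sum>n<N. c * f n b) - c * v b))\<^sup>2 \<partial>M)
      = (cmod c)\<^sup>2 * (\<integral>b. (cmod ((\<Sum>n<N. f n b) - v b))\<^sup>2 \<partial>M)" for N
    by (simp add: sum_distrib_left[symmetric] right_diff_distrib[symmetric] norm_mult
        power_mult_distrib)
  then show ?thesis
    using assms by (auto simp: L2_sums_def square_integrable_cmult intro: tendsto_mult_right_zero)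
qed

lemma L2_sums_zero: "L2_sums M (\<lambda>_ _. 0) (\<lambda>_. 0)"
  by (simp add: L2_sums_def square_integrable_def)

lemma L2_sums_sum:
  assumes "\<And>x. x \<in> F \<Longrightarrow> L2_sums M (f x) (v x)"
  shows "L2_sums M (\<lambda>n b. \<Sum>x\<in>F. f x n b) (\<lambda>b. \<Sum>x\<in>F. v x b)"
  using assms
  by (induction F rule: infinite_finite_induct) (simp_all add: L2_sums_zero L2_sums_add)

section \<open>Series of independent standard normal variables\<close>

lemma square_integrable_std_normal:
  assumes "distributed M lborel Y std_normal_density"
  shows "square_integrable M (\<lambda>\<omega>. complex_of_real (Y \<omega>))"
proof -
  have "integrable M (\<lambda>\<omega>. (Y \<omega>)\<^sup>2)"
    using distributed_integrable[OF assms, of "\<lambda>x. x\<^sup>2"] integrable_std_normal_moment[of 2] by simp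
  moreover have "Y \<in> borel_measurable M"
    using distributed_measurable[OF assms] by simp
  ultimately show ?thesis
    by (simp add: square_integrable_def)
qed

context
  fixes M :: "'w measure" and Z :: "nat \<Rightarrow> 'w \<Rightarrow> real"
  assumes iid: "iid_standard_normal M Z"
begin

interpretation prob_space M
  using iid by (simp add: iid_standard_normal_def)

lemma iid_indep: "indep_vars (\<lambda>_. borel) Z A"
  using iid indep_vars_subset[of "\<lambda>_. borel" Z UNIV A] by (simp add: iid_standard_normal_def)

lemma iid_distributed: "distributed M lborel (Z n) std_normal_density"
  using iid by (simp add: iid_standard_normal_def)

lemma iid_measurable [measurable]: "Z n \<in> borel_measurable M"
  using distributed_measurable[OF iid_distributed] by simp

lemma iid_square_integrable: "square_integrable M (\<lambda>\<omega>. a * complex_of_real (Z n \<omega>))"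
  by (intro square_integrable_cmult square_integrable_std_normal iid_distributed)

lemma iid_expectation_mult: "(\<integral>\<omega>. Z i \<omega> * Z j \<omega> \<partial>M) = (if i = j then 1 else 0)"
proof (cases "i = j")
  case True
  then show ?thesis
    using standard_normal_distributed_variance[OF iid_distributed, of j]
      standard_normal_distributed_expectation[OF iid_distributed, of j]
    by (simp add: power2_eq_square)
next
  case False
  have "integrable M (Z n)" for n
    using distributed_integrable[OF iid_distributed, of "\<lambda>x. x" n] integrable_std_normal_moment[of 1]
    by simp
  \<comment> \<open>Independence factorises the expectation of a product over a finite index set;
    for \<open>i \<noteq> j\<close> this is a product of two zero means.\<close>
  then have "(\<integral>\<omega>. (\<Prod>n\<in>{i, j}. Z n \<omega>) \<partial>M) = (\<Prod>n\<in>{i, j}. \<integral>\<omega>. Z n \<omega> \<partial>M)"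
    by (intro indep_vars_lebesgue_integral iid_indep) auto
  then show ?thesis
    using False by (simp add: standard_normal_distributed_expectation[OF iid_distributed])
qed

text \<open>Orthonormality of the \<open>Z n\<close> removes the off-diagonal terms of the expanded
  product. The case \<open>b = a\<close> yields norms, the general case covariances.\<close>

lemma iid_L2_isometry:
  assumes "finite A"
  shows "(\<integral>\<omega>. (\<Sum>n\<in>A. a n * complex_of_real (Z n \<omega>)) * cnj (\<Sum>n\<in>A. b n * complex_of_real (Z n \<omega>)) \<partial>M)
    = (\<Sum>n\<in>A. a n * cnj (b n))"
proof -
  have int: "integrable M (\<lambda>\<omega>. (a i * complex_of_real (Z i \<omega>)) * cnj (b j * complex_of_real (Z j \<omega>)))" for i j
    by (intro integrable_mult_square_integrable square_integrable_cnj iid_square_integrable)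
  \<comment> \<open>The value is written with \<open>b i\<close> and the test \<open>j = i\<close>
    so that the inner sum over \<open>j\<close> collapses to its diagonal term.\<close>
  have val: "(\<integral>\<omega>. (a i * complex_of_real (Z i \<omega>)) * cnj (b j * complex_of_real (Z j \<omega>)) \<partial>M)
      = (if j = i then a i * cnj (b i) else 0)" for i j
  proof -
    have "(\<integral>\<omega>. (a i * complex_of_real (Z i \<omega>)) * cnj (b j * complex_of_real (Z j \<omega>)) \<partial>M)
        = (\<integral>\<omega>. (a i * cnj (b j)) * complex_of_real (Z i \<omega> * Z j \<omega>) \<partial>M)"
      by (intro Bochner_Integration.integral_cong) auto
    also have "\<dots> = (a i * cnj (b j)) * complex_of_real (\<integral>\<omega>. Z i \<omega> * Z j \<omega> \<partial>M)"
      by (simp del: of_real_mult)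
    finally show ?thesis by (simp add: iid_expectation_mult)
  qed
  have "(\<integral>\<omega>. (\<Sum>n\<in>A. a n * complex_of_real (Z n \<omega>)) * cnj (\<Sum>n\<in>A. b n * complex_of_real (Z n \<omega>)) \<partial>M)
      = (\<integral>\<omega>. (\<Sum>i\<in>A. \<Sum>j\<in>A. (a i * complex_of_real (Z i \<omega>)) * cnj (b j * complex_of_real (Z j \<omega>))) \<partial>M)"
    by (simp only: cnj_sum sum_product)
  also have "\<dots> = (\<Sum>i\<in>A. \<Sum>j\<in>A.
      \<integral>\<omega>. (a i * complex_of_real (Z i \<omega>)) * cnj (b j * complex_of_real (Z j \<omega>)) \<partial>M)"
    by (simp only: Bochner_Integration.integral_sum Bochner_Integration.integrable_sum int)
  also have "\<dots> = (\<Sum>n\<in>A. a n * cnj (b n))"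
    unfolding val using assms by (simp add: sum.delta)
  finally show ?thesis .
qed

lemma iid_L2_norm:
  assumes "finite A"
  shows "(\<integral>\<omega>. (cmod (\<Sum>n\<in>A. a n * complex_of_real (Z n \<omega>)))\<^sup>2 \<partial>M) = (\<Sum>n\<in>A. (cmod (a n))\<^sup>2)"
proof -
  have "complex_of_real (\<integral>\<omega>. (cmod (\<Sum>n\<in>A. a n * complex_of_real (Z n \<omega>)))\<^sup>2 \<partial>M)
      = complex_of_real (\<Sum>n\<in>A. (cmod (a n))\<^sup>2)"
    using iid_L2_isometry[OF assms, of a a]
    by (simp only: complex_norm_square[symmetric] integral_complex_of_real of_real_sum[symmetric])
  then show ?thesis by (simp only: of_real_eq_iff)
qed

text \<open>By the isometry, the squared distance of two partial sums is a block of the series of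
  \<open>(cmod (a n))\<^sup>2\<close>, so the Cauchy criterion transfers.\<close>

lemma iid_L2_sums_ex:
  assumes summ: "summable (\<lambda>n. (cmod (a n))\<^sup>2)"
  shows "\<exists>v. L2_sums M (\<lambda>n \<omega>. a n * complex_of_real (Z n \<omega>)) v"
proof -
  define s where "s N \<omega> = (\<Sum>n<N. a n * complex_of_real (Z n \<omega>))" for N \<omega>
  have sym: "(\<integral>\<omega>. (cmod (s i \<omega> - s j \<omega>))\<^sup>2 \<partial>M) = (\<integral>\<omega>. (cmod (s j \<omega> - s i \<omega>))\<^sup>2 \<partial>M)" for i j
    by (simp add: norm_minus_commute)
  have diff: "(\<integral>\<omega>. (cmod (s i \<omega> - s j \<omega>))\<^sup>2 \<partial>M) = (\<Sum>n\<in>{j..<i}. (cmod (a n))\<^sup>2)" if "j \<le> i" for i j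
  proof -
    have "s i \<omega> - s j \<omega> = (\<Sum>n\<in>{j..<i}. a n * complex_of_real (Z n \<omega>))" for \<omega>
      unfolding s_def lessThan_atLeast0 using that by (simp add: sum_diff_nat_ivl)
    then show ?thesis by (simp add: iid_L2_norm)
  qed
  obtain v where "square_integrable M v" "(\<lambda>n. \<integral>\<omega>. (cmod (s n \<omega> - v \<omega>))\<^sup>2 \<partial>M) \<longlonglongrightarrow> 0"
  proof (rule L2_complete)
    show "square_integrable M (s n)" for n
      unfolding s_def by (intro square_integrable_sum iid_square_integrable)
    fix e :: real assume "e > 0"
    then obtain N where N: "\<And>m n. m \<ge> N \<Longrightarrow> norm (\<Sum>k\<in>{m..<n}. (cmod (a k))\<^sup>2) < e"
      using summ unfolding summable_Cauchy by blast
    have "(\<integral>\<omega>. (cmod (s i \<omega> - s j \<omega>))\<^sup>2 \<partial>M) < e" if "i \<ge> N" "j \<ge> N" for i j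
    proof (cases "j \<le> i")
      case True
      then show ?thesis using N[OF \<open>j \<ge> N\<close>, of i] by (simp add: diff)
    next
      case False
      then show ?thesis using N[OF \<open>i \<ge> N\<close>, of j] by (subst sym) (simp add: diff)
    qed
    then show "\<exists>N. \<forall>i\<ge>N. \<forall>j\<ge>N. (\<integral>\<omega>. (cmod (s i \<omega> - s j \<omega>))\<^sup>2 \<partial>M) < e"
      by blast
  qed
  then show ?thesis
    by (auto simp: L2_sums_def s_def iid_square_integrable)
qed

text \<open>The covariances of the partial sums are the partial sums of the series. With
  \<open>W = V\<close> this also recovers square summability of the coefficients from L2
  convergence.\<close>

lemma iid_L2_sums_covariance:
  assumes V: "L2_sums M (\<lambda>n \<omega>. a n * complex_of_real (Z n \<omega>)) V"
    and W: "L2_sums M (\<lambda>n \<omega>. b n * complex_of_real (Z n \<omega>)) W"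
  shows "(\<lambda>n. a n * cnj (b n)) sums (\<integral>\<omega>. V \<omega> * cnj (W \<omega>) \<partial>M)"
proof -
  have "(\<lambda>N. \<integral>\<omega>. (\<Sum>n<N. a n * complex_of_real (Z n \<omega>))
        * cnj (\<Sum>n<N. b n * complex_of_real (Z n \<omega>)) \<partial>M)
      \<longlonglongrightarrow> (\<integral>\<omega>. V \<omega> * cnj (W \<omega>) \<partial>M)"
    using V W unfolding L2_sums_def
    by (intro tendsto_integral_mult_cnj_L2 square_integrable_sum) auto
  then show ?thesis
    by (simp only: iid_L2_isometry finite_lessThan sums_def)
qed

lemma iid_char_sum:
  fixes c :: "nat \<Rightarrow> real"
  shows "char (distr M borel (\<lambda>\<omega>. \<Sum>n\<in>A. c n * Z n \<omega>)) t
    = complex_of_real (exp (- (\<Sum>n\<in>A. (c n)\<^sup>2) * t\<^sup>2 / 2))"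
proof -
  have Z: "char (distr M borel (\<lambda>\<omega>. c n * Z n \<omega>)) t = complex_of_real (exp (- (c n)\<^sup>2 * t\<^sup>2 / 2))" for n
  proof -
    have "char (distr M borel (\<lambda>\<omega>. c n * Z n \<omega>)) t = char (distr M borel (Z n)) (t * c n)"
      by (simp add: char_def integral_distr mult.assoc)
    also have "distr M borel (Z n) = std_normal_distribution"
      using distributed_distr_eq_density[OF iid_distributed, of n]
      by (metis distr_cong sets_lborel)
    finally show ?thesis
      by (simp add: char_std_normal_distribution power_mult_distrib mult.commute)
  qed
  have "indep_vars (\<lambda>_. borel) (\<lambda>n \<omega>. c n * Z n \<omega>) A"
    by (rule indep_vars_compose2[OF iid_indep]) measurable
  then have "char (distr M borel (\<lambda>\<omega>. \<Sum>n\<in>A. c n * Z n \<omega>)) t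
      = complex_of_real (\<Prod>n\<in>A. exp (- (c n)\<^sup>2 * t\<^sup>2 / 2))"
    by (simp only: char_distr_sum Z of_real_prod)
  also have "(\<Prod>n\<in>A. exp (- (c n)\<^sup>2 * t\<^sup>2 / 2)) = exp (- (\<Sum>n\<in>A. (c n)\<^sup>2) * t\<^sup>2 / 2)"
    \<comment> \<open>For infinite \<open>A\<close> the product is 1 and the sum is 0 by convention,
      and the equation reads \<open>1 = exp 0\<close>.\<close>
    by (cases "finite A")
       (simp_all add: exp_sum[symmetric] sum_negf sum_distrib_right sum_divide_distrib)
  finally show ?thesis .
qed

end

section \<open>Characteristic functions and normality of limits\<close>

text \<open>After the unimodular factor \<open>iexp y\<close> is pulled out, this is the Taylor
  estimate of order 0 at \<open>x - y\<close>.\<close>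

lemma norm_iexp_diff_le: "cmod (iexp x - iexp y) \<le> \<bar>x - y\<bar>"
proof -
  have "iexp x - iexp y = iexp y * (iexp (x - y) - 1)"
    by (simp add: right_diff_distrib flip: exp_add)
  then have "cmod (iexp x - iexp y) = cmod (iexp (x - y) - 1)"
    by (simp only: norm_mult norm_exp_i_times mult_1)
  also have "\<dots> \<le> \<bar>x - y\<bar>"
    using iexp_approx1[of "x - y" 0] by simp
  finally show ?thesis .
qed

text \<open>The Lipschitz bound on \<open>iexp\<close> is integrated: at each \<open>t\<close> the
  characteristic functions differ by at most \<open>\<bar>t\<bar>\<close> times the L1
  distance.\<close>

lemma (in prob_space) tendsto_char_L1:
  fixes S :: "nat \<Rightarrow> 'a \<Rightarrow> real"
  assumes S: "\<And>n. integrable M (S n)" and Y: "integrable M Y"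
    and lim: "(\<lambda>n. \<integral>\<omega>. \<bar>S n \<omega> - Y \<omega>\<bar> \<partial>M) \<longlonglongrightarrow> 0"
  shows "(\<lambda>n. char (distr M borel (S n)) t) \<longlonglongrightarrow> char (distr M borel Y) t"
proof (rule Lim_null_comparison[THEN LIM_zero_cancel])
  have [measurable]: "S n \<in> borel_measurable M" "Y \<in> borel_measurable M" for n
    using S Y by auto
  show "\<forall>\<^sub>F n in sequentially.
      norm (char (distr M borel (S n)) t - char (distr M borel Y) t) \<le> \<bar>t\<bar> * (\<integral>\<omega>. \<bar>S n \<omega> - Y \<omega>\<bar> \<partial>M)"
  proof (intro always_eventually allI)
    fix n
    have int: "integrable M (\<lambda>\<omega>. iexp (t * S n \<omega>))" "integrable M (\<lambda>\<omega>. iexp (t * Y \<omega>))"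
      by (auto intro!: integrable_iexp)
    have "char (distr M borel (S n)) t - char (distr M borel Y) t
        = (\<integral>\<omega>. iexp (t * S n \<omega>) - iexp (t * Y \<omega>) \<partial>M)"
      using int by (simp add: char_def integral_distr)
    also have "norm \<dots> \<le> (\<integral>\<omega>. norm (iexp (t * S n \<omega>) - iexp (t * Y \<omega>)) \<partial>M)"
      by (rule integral_norm_bound)
    also have "\<dots> \<le> (\<integral>\<omega>. \<bar>t\<bar> * \<bar>S n \<omega> - Y \<omega>\<bar> \<partial>M)"
    proof (rule integral_mono)
      show "integrable M (\<lambda>\<omega>. norm (iexp (t * S n \<omega>) - iexp (t * Y \<omega>)))"
        using int by (intro integrable_norm Bochner_Integration.integrable_diff)
      show "integrable M (\<lambda>\<omega>. \<bar>t\<bar> * \<bar>S n \<omega> - Y \<omega>\<bar>)"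
        using S Y by auto
      show "norm (iexp (t * S n \<omega>) - iexp (t * Y \<omega>)) \<le> \<bar>t\<bar> * \<bar>S n \<omega> - Y \<omega>\<bar>" for \<omega>
        using norm_iexp_diff_le[of "t * S n \<omega>" "t * Y \<omega>"]
        by (simp only: right_diff_distrib[symmetric] abs_mult)
    qed
    finally show "norm (char (distr M borel (S n)) t - char (distr M borel Y) t)
        \<le> \<bar>t\<bar> * (\<integral>\<omega>. \<bar>S n \<omega> - Y \<omega>\<bar> \<partial>M)"
      by simp
  qed
  show "(\<lambda>n. \<bar>t\<bar> * (\<integral>\<omega>. \<bar>S n \<omega> - Y \<omega>\<bar> \<partial>M)) \<longlonglongrightarrow> 0"
    using tendsto_mult_right_zero[OF lim] .
qed

text \<open>Dividing by \<open>sqrt s\<close> reduces the claim to the standard normal law, whose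
  characteristic function is known; scaling back gives standard deviation
  \<open>sqrt s\<close>.\<close>

lemma (in prob_space) gaussian_rv_if_char:
  assumes Y [measurable]: "Y \<in> borel_measurable M" and s: "s > 0"
    and char: "\<And>t. char (distr M borel Y) t = complex_of_real (exp (- s * t\<^sup>2 / 2))"
  shows "gaussian_rv M Y"
proof -
  have "distr M borel (\<lambda>\<omega>. Y \<omega> / sqrt s) = std_normal_distribution"
  proof (rule Levy_uniqueness)
    show "real_distribution (distr M borel (\<lambda>\<omega>. Y \<omega> / sqrt s))"
      by (rule real_distribution_distr) measurable
    show "real_distribution std_normal_distribution"
      by (rule real_dist_normal_dist)
    show "char (distr M borel (\<lambda>\<omega>. Y \<omega> / sqrt s)) = char std_normal_distribution"
    proof
      fix t
      have "char (distr M borel (\<lambda>\<omega>. Y \<omega> / sqrt s)) t = char (distr M borel Y) (t / sqrt s)"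
        by (simp add: char_def integral_distr)
      then show "char (distr M borel (\<lambda>\<omega>. Y \<omega> / sqrt s)) t = char std_normal_distribution t"
        using s by (simp add: char char_std_normal_distribution power_divide)
    qed
  qed
  \<comment> \<open>The trivial \<open>- 0\<close> matches the form in which
    \<open>normal_standard_normal_convert\<close> standardises a variable of mean 0.\<close>
  then have "distributed M lborel (\<lambda>\<omega>. (Y \<omega> - 0) / sqrt s) std_normal_density"
    unfolding distributed_def by (auto simp: distr_cong[OF refl sets_lborel])
  then have "distributed M lborel Y (normal_density 0 (sqrt s))"
    using s by (subst normal_standard_normal_convert) auto
  then show ?thesis
    using Y s unfolding gaussian_rv_def
    by (intro conjI exI[of _ 0] disjI1 exI[of _ "sqrt s"]) simp_all
qed

text \<open>As the \<open>Z n\<close> are real, taking real parts only replaces \<open>a n\<close>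
  by \<open>Re (a n)\<close>. The limit variance \<open>s\<close> is the sum of the squares of these
  coefficients, and \<open>s = 0\<close> is the degenerate case.\<close>

lemma gaussian_rv_Re_L2_sums:
  assumes iid: "iid_standard_normal M Z"
    and U: "L2_sums M (\<lambda>n \<omega>. a n * complex_of_real (Z n \<omega>)) U"
  shows "gaussian_rv M (\<lambda>\<omega>. Re (U \<omega>))"
proof -
  interpret prob_space M
    using iid by (simp add: iid_standard_normal_def)
  define S where "S N \<omega> = (\<Sum>n<N. a n * complex_of_real (Z n \<omega>))" for N \<omega>
  have S: "square_integrable M (S N)" for N
    unfolding S_def by (intro square_integrable_sum iid_square_integrable iid)
  have U_sq: "square_integrable M U" and SU: "(\<lambda>N. \<integral>\<omega>. (cmod (S N \<omega> - U \<omega>))\<^sup>2 \<partial>M) \<longlonglongrightarrow> 0"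
    using U by (auto simp: L2_sums_def S_def)
  note [measurable] = S U_sq
  have int: "integrable M (\<lambda>\<omega>. Re (S N \<omega>))" "integrable M (\<lambda>\<omega>. Re (U \<omega>))" for N
    using integrable_if_square_integrable[OF S] integrable_if_square_integrable[OF U_sq] by auto
  have L1: "(\<lambda>N. \<integral>\<omega>. \<bar>Re (S N \<omega>) - Re (U \<omega>)\<bar> \<partial>M) \<longlonglongrightarrow> 0"
  proof (rule Lim_null_comparison)
    show "\<forall>\<^sub>F N in sequentially. norm (\<integral>\<omega>. \<bar>Re (S N \<omega>) - Re (U \<omega>)\<bar> \<partial>M)
        \<le> sqrt (\<integral>\<omega>. (cmod (S N \<omega> - U \<omega>))\<^sup>2 \<partial>M)"
    proof (intro always_eventually allI)
      fix N
      have "(\<integral>\<omega>. \<bar>Re (S N \<omega>) - Re (U \<omega>)\<bar> \<partial>M) \<le> (\<integral>\<omega>. cmod (S N \<omega> - U \<omega>) \<partial>M)"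
        using integrable_if_square_integrable[OF square_integrable_diff[OF S[of N] U_sq]] int
        by (intro integral_mono) (auto simp: abs_Re_le_cmod simp flip: minus_complex.sel)
      also have "\<dots> \<le> sqrt (\<integral>\<omega>. (cmod (S N \<omega> - U \<omega>))\<^sup>2 \<partial>M)"
        using L1_norm_le_L2_norm[OF square_integrable_diff[OF S[of N] U_sq]] by (simp add: prob_space)
      finally show "norm (\<integral>\<omega>. \<bar>Re (S N \<omega>) - Re (U \<omega>)\<bar> \<partial>M)
          \<le> sqrt (\<integral>\<omega>. (cmod (S N \<omega> - U \<omega>))\<^sup>2 \<partial>M)"
        by (simp add: integral_nonneg_AE)
    qed
    show "(\<lambda>N. sqrt (\<integral>\<omega>. (cmod (S N \<omega> - U \<omega>))\<^sup>2 \<partial>M)) \<longlonglongrightarrow> 0"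
      using tendsto_real_sqrt[OF SU] by simp
  qed
  have ReS: "Re (S N \<omega>) = (\<Sum>n<N. Re (a n) * Z n \<omega>)" for N \<omega>
    by (simp add: S_def)
  \<comment> \<open>Square summability comes from the covariance series of \<open>U\<close> with
    itself.\<close>
  have "summable (\<lambda>n. (cmod (a n))\<^sup>2)"
    using sums_summable[OF iid_L2_sums_covariance[OF iid U U]]
    by (simp only: complex_norm_square[symmetric] summable_complex_of_real)
  then have summ: "summable (\<lambda>n. (Re (a n))\<^sup>2)"
    by (rule summable_comparison_test'[where N = 0]) (simp add: cmod_power2)
  define s where "s = (\<Sum>n. (Re (a n))\<^sup>2)"
  have "s \<ge> 0"
    unfolding s_def by (intro suminf_nonneg summ) auto
  then consider "s > 0" | "s = 0" by linarith
  then show ?thesis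
  proof cases
    case 1
    have "char (distr M borel (\<lambda>\<omega>. Re (U \<omega>))) t = complex_of_real (exp (- s * t\<^sup>2 / 2))" for t
    proof (rule LIMSEQ_unique)
      show "(\<lambda>N. char (distr M borel (\<lambda>\<omega>. Re (S N \<omega>))) t)
          \<longlonglongrightarrow> char (distr M borel (\<lambda>\<omega>. Re (U \<omega>))) t"
        by (intro tendsto_char_L1 int L1)
      have "(\<lambda>N. \<Sum>n<N. (Re (a n))\<^sup>2) \<longlonglongrightarrow> s"
        unfolding s_def using summ by (rule summable_LIMSEQ)
      then have "(\<lambda>N. complex_of_real (exp (- (\<Sum>n<N. (Re (a n))\<^sup>2) * t\<^sup>2 / 2)))
          \<longlonglongrightarrow> complex_of_real (exp (- s * t\<^sup>2 / 2))"
        by (intro tendsto_intros) auto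
      then show "(\<lambda>N. char (distr M borel (\<lambda>\<omega>. Re (S N \<omega>))) t)
          \<longlonglongrightarrow> complex_of_real (exp (- s * t\<^sup>2 / 2))"
        by (simp only: ReS iid_char_sum[OF iid])
    qed
    then show ?thesis
      using 1 by (intro gaussian_rv_if_char[of _ s]) (auto intro: borel_measurable_integrable int)
  next
    case 2
    then have "Re (a n) = 0" for n
      using suminf_eq_zero_iff[OF summ] by (simp add: s_def)
    \<comment> \<open>All partial sums have real part 0, so the sequence in \<open>L1\<close> is
      constant and equals its limit 0.\<close>
    then have "(\<integral>\<omega>. \<bar>Re (U \<omega>)\<bar> \<partial>M) = 0"
      using L1 by (simp add: ReS LIMSEQ_const_iff)
    then have "AE \<omega> in M. Re (U \<omega>) = 0"
      using integral_nonneg_eq_0_iff_AE[of M "\<lambda>\<omega>. \<bar>Re (U \<omega>)\<bar>"] int by auto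
    then show ?thesis
      using borel_measurable_integrable[OF int(2)] by (auto simp: gaussian_rv_def)
  qed
qed

text \<open>All \<open>V x\<close> are series in the same variables \<open>Z n\<close>, so a finite
  linear combination is again one such series and joint normality reduces to the case of a single
  series.\<close>

lemma gaussian_process_L2_sums:
  fixes X :: "'x set"
  assumes iid: "iid_standard_normal M Z"
    and V: "\<And>x. x \<in> X \<Longrightarrow> L2_sums M (\<lambda>n \<omega>. \<phi> n x * complex_of_real (Z n \<omega>)) (V x)"
  shows "gaussian_process M X V"
  unfolding gaussian_process_def jointly_gaussian_def
proof (intro allI impI)
  fix F :: "'x set" and a :: "'x + 'x \<Rightarrow> real"
  assume F: "finite F" "F \<subseteq> X"
  \<comment> \<open>A real combination of real and imaginary parts is the real part of a complex
    combination: \<open>p Re z + q Im z = Re ((p - \<i> q) z)\<close>.\<close>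
  define w where "w x = Complex (a (Inl x)) (- a (Inr x))" for x
  have "L2_sums M (\<lambda>n \<omega>. \<Sum>x\<in>F. w x * (\<phi> n x * complex_of_real (Z n \<omega>))) (\<lambda>\<omega>. \<Sum>x\<in>F. w x * V x \<omega>)"
    using F by (intro L2_sums_sum L2_sums_cmult V) auto
  then have "L2_sums M (\<lambda>n \<omega>. (\<Sum>x\<in>F. w x * \<phi> n x) * complex_of_real (Z n \<omega>))
      (\<lambda>\<omega>. \<Sum>x\<in>F. w x * V x \<omega>)"
    by (simp add: sum_distrib_right mult.assoc)
  from gaussian_rv_Re_L2_sums[OF iid this]
  have "gaussian_rv M (\<lambda>\<omega>. Re (\<Sum>x\<in>F. w x * V x \<omega>))" .
  moreover have "Re (\<Sum>x\<in>F. w x * V x \<omega>)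
      = (\<Sum>j\<in>F <+> F. a j * case_sum (\<lambda>x \<omega>. Re (V x \<omega>)) (\<lambda>x \<omega>. Im (V x \<omega>)) j \<omega>)" for \<omega>
    using F by (simp add: w_def sum.Plus sum.distrib)
  ultimately show "gaussian_rv M
      (\<lambda>\<omega>. \<Sum>j\<in>F <+> F. a j * case_sum (\<lambda>x \<omega>. Re (V x \<omega>)) (\<lambda>x \<omega>. Im (V x \<omega>)) j \<omega>)"
    by simp
qed

section \<open>Kernel expansion and the main result\<close>

lemma is_boundary_count_space:
  assumes K: "\<And>x y. x \<in> X \<Longrightarrow> y \<in> X \<Longrightarrow> (\<lambda>n. \<phi> n x * cnj (\<phi> n y)) sums K x y"
  shows "is_boundary X K (count_space (UNIV :: nat set))"
  unfolding is_boundary_def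
proof (intro exI conjI ballI)
  \<comment> \<open>The conjugate is needed because the boundary formula conjugates its first
    factor.\<close>
  let ?k = "\<lambda>x n. cnj (\<phi> n x)"
  show sq: "square_integrable (count_space UNIV) (?k x)" if "x \<in> X" for x
    \<comment> \<open>On the diagonal the terms of the kernel series are
      \<open>(cmod (\<phi> n x))\<^sup>2\<close>.\<close>
    using sums_summable[OF K[OF that that]]
    unfolding complex_norm_square[symmetric] summable_complex_of_real
    by (simp add: square_integrable_def integrable_count_space_nat_iff)
  fix x y assume xy: "x \<in> X" "y \<in> X"
  have "integrable (count_space UNIV) (\<lambda>n. cnj (?k x n) * ?k y n)"
    by (intro integrable_mult_square_integrable square_integrable_cnj sq xy)
  then show "K x y = (\<integral>n. cnj (?k x n) * ?k y n \<partial>count_space UNIV)"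
    using sums_unique[OF K[OF xy]] by (simp add: integral_count_space_nat)
qed

text \<open>The polarised identity is applied to two kernel sections, whose frame coefficients are
  conjugated point values of \<open>\<phi> n\<close> by the reproducing property.\<close>

lemma (in rkhs) parseval_frame_kernel_sums:
  assumes frame: "parseval_frame H ip \<phi>" and x: "x \<in> X" and y: "y \<in> X"
  shows "(\<lambda>n. \<phi> n x * cnj (\<phi> n y)) sums K x y"
proof -
  let ?k = "\<lambda>y. \<lambda>t\<in>X. K t y"
  have ev: "cnj (ip (\<phi> n) (?k z)) = \<phi> n z" if "z \<in> X" for n z
    using frame that reproducing[of z "\<phi> n"] ip_cnj[of "\<phi> n" "?k z"] kernel_mem[of z]
    by (simp add: parseval_frame_def)
  \<comment> \<open>The double conjugate lets \<open>ev\<close> rewrite both factors.\<close>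
  have "(\<lambda>n. cnj (ip (\<phi> n) (?k x)) * cnj (cnj (ip (\<phi> n) (?k y)))) sums ip (?k x) (?k y)"
    using parseval_frame_ip_sums[OF frame kernel_mem[OF x] kernel_mem[OF y]] by simp
  moreover have "ip (?k x) (?k y) = K x y"
    using reproducing[OF x kernel_mem[OF y]] x by simp
  ultimately show ?thesis
    by (simp only: ev x y)
qed

text \<open>An L2 limit is determined only up to null sets, so the second assertion combines
  existence of the limits with a claim about every family \<open>V\<close> of such limits.\<close>

theorem theorem3p4:
  fixes X :: "'x set"
    and K :: "'x \<Rightarrow> 'x \<Rightarrow> complex"
    and H :: "('x \<Rightarrow> complex) set"
    and ip :: "('x \<Rightarrow> complex) \<Rightarrow> ('x \<Rightarrow> complex) \<Rightarrow> complex"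
    and \<phi> :: "nat \<Rightarrow> 'x \<Rightarrow> complex"
  assumes "pd_kernel X K"
    and "rkhs X K H ip"
    and "parseval_frame H ip \<phi>"
  shows "(\<forall>x\<in>X. \<forall>y\<in>X. (\<lambda>n. \<phi> n x * cnj (\<phi> n y)) sums K x y) \<and>
         is_boundary X K (count_space (UNIV :: nat set)) \<and>
         (\<forall>(M :: 'w measure) Z. iid_standard_normal M Z \<longrightarrow>
            (\<forall>x\<in>X. \<exists>v. L2_sums M (\<lambda>n \<omega>. \<phi> n x * complex_of_real (Z n \<omega>)) v) \<and>
            (\<forall>V. (\<forall>x\<in>X. L2_sums M (\<lambda>n \<omega>. \<phi> n x * complex_of_real (Z n \<omega>)) (V x)) \<longrightarrow>
               gaussian_process M X V \<and>
               (\<forall>x\<in>X. \<forall>y\<in>X. (\<integral>\<omega>. V x \<omega> * cnj (V y \<omega>) \<partial>M) = K x y)))"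
proof (intro conjI allI impI ballI)
  show K: "(\<lambda>n. \<phi> n x * cnj (\<phi> n y)) sums K x y" if "x \<in> X" "y \<in> X" for x y
    by (rule rkhs.parseval_frame_kernel_sums[OF assms(2,3) that])
  show "is_boundary X K (count_space (UNIV :: nat set))"
    by (rule is_boundary_count_space[OF K])
  fix M :: "'w measure" and Z
  assume iid: "iid_standard_normal M Z"
  show "\<exists>v. L2_sums M (\<lambda>n \<omega>. \<phi> n x * complex_of_real (Z n \<omega>)) v" if "x \<in> X" for x
    \<comment> \<open>The kernel series at \<open>(x, x)\<close> provides the square summability
      that convergence in L2 requires.\<close>
    using sums_summable[OF K[OF that that]]
    unfolding complex_norm_square[symmetric] summable_complex_of_real
    by (rule iid_L2_sums_ex[OF iid])
  fix V
  assume V: "\<forall>x\<in>X. L2_sums M (\<lambda>n \<omega>. \<phi> n x * complex_of_real (Z n \<omega>)) (V x)"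
  show "gaussian_process M X V"
    using V by (intro gaussian_process_L2_sums[OF iid]) auto
  show "(\<integral>\<omega>. V x \<omega> * cnj (V y \<omega>) \<partial>M) = K x y" if "x \<in> X" "y \<in> X" for x y
    using V that by (intro sums_unique2[OF iid_L2_sums_covariance[OF iid] K]) auto
qed

end
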